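(* Let $n\ge 1$, $T>0$, let $X\subset\mathbb{R}^n$ be open and let $f\in C^3(X\times(0,T);\mathbb{R}^n)$. There exists a meagre set (respectively, there exists a set of zero Lebesgue measure) $N\subset\mathbb{R}^n\times\mathbb{M}^{n\times n}$ such that for every $(y,K)\in(\mathbb{R}^n\times\mathbb{M}^{n\times n})\setminus N$ the map $$\tilde f: X\times(0,T)\to\mathbb{R}^n,\qquad \tilde f(x,t):=f(x,t)+y+K[x],$$ satisfies the transversality conditions (i.e. (T1), (T2), (T3) hold for $\tilde f$ at every point of the singular set of $\tilde f$).
   Context: Notation: $\mathbb{M}^{n\times n}$ is the space of real $n\times n$ matrices, and $K[x]$ is the action of the matrix $K$ on the vector $x$; $\langle\cdot,\cdot\rangle$ is the scalar product of $\mathbb{R}^n$; $\mathsf N(\cdot)$ denotes the null space and $^*$ the transpose. A set is meagre if it is contained in a countable union of nowhere dense sets. For a $C^2$ map $h:X\times(0,T)\to\mathbb{R}^n$, define the singular set $\mathcal S:=\{(x,t)\in X\times(0,T): h(x,t)=0,\ D_xh(x,t)\text{ is not invertible}\}$. Transversality conditions for $h$ at a point $(x_0,t_0)\in\mathcal S$: (T1) $\dim \mathsf N(D_xh(x_0,t_0))=1$ (and therefore $\dim \mathsf N(D_xh(x_0,t_0)^* )=1$); (T2) if $0\neq w^*\in \mathsf N(D_xh(x_0,t_0)^* )$, then $\langle\partial_t h(x_0,t_0),w^*\rangle\neq0$; (T3) if $0\neq v\in \mathsf N(D_xh(x_0,t_0))$ and $0\ne w^*\in \mathsf N(D_xh(x_0,t_0)^*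 )$, then $\langle D_x^2h(x_0,t_0)[v,v],w^*\rangle\neq0$. $h$ satisfies the transversality conditions if they hold at every point of $\mathcal S$. *)

theory Defs
  imports "HOL-Analysis.Analysis"
begin

text \<open>
  Regularity of class \<open>C\<^sup>k\<close> on an open set \<open>S\<close>. In finite dimension, continuity of the
  \<open>k\<close>-th derivative amounts to continuity of all iterated directional derivatives of order \<open>k\<close>,
  so the recursion goes through \<open>\<lambda>x. Df(x)[v]\<close> and avoids types of iterated linear maps.
  Derivatives are taken at \<open>x\<close> in the full space: only meaningful for open \<open>S\<close>.
\<close>

primrec Ck_on :: "nat \<Rightarrow> ('a::euclidean_space \<Rightarrow> 'b::euclidean_space) \<Rightarrow> 'a set \<Rightarrow> bool" where
  "Ck_on 0 f S \<longleftrightarrow> continuous_on S f"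
| "Ck_on (Suc k) f S \<longleftrightarrow>
     (\<forall>x\<in>S. f differentiable (at x)) \<and>
     (\<forall>v. Ck_on k (\<lambda>x. frechet_derivative f (at x) v) S)"

definition nowhere_dense :: "'a::topological_space set \<Rightarrow> bool" where
  "nowhere_dense A \<longleftrightarrow> interior (closure A) = {}"

definition meagre :: "'a::topological_space set \<Rightarrow> bool" where
  "meagre A \<longleftrightarrow> (\<exists>\<A>. countable \<A> \<and> (\<forall>B\<in>\<A>. nowhere_dense B) \<and> A \<subseteq> \<Union>\<A>)"

definition null_space :: "real^'n^'m \<Rightarrow> (real^'n) set" where
  "null_space A = {v. A *v v = 0}"

definition Dx :: "((real^'n) \<times> real \<Rightarrow> real^'n) \<Rightarrow> real^'n \<Rightarrow> real \<Rightarrow> real^'n^'n" where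
  "Dx h x t = jacobian (\<lambda>z. h (z, t)) (at x)"

text \<open>\<open>D2x h x t u v\<close> is \<open>D\<^sub>x\<^sup>2 h(x,t)[u,v]\<close>: the matrix field \<open>D\<^sub>x h(\<cdot>,t)\<close> is differentiated
  at \<open>x\<close> in direction \<open>u\<close> and the resulting matrix is applied to \<open>v\<close>.\<close>

definition D2x ::
  "((real^'n) \<times> real \<Rightarrow> real^'n) \<Rightarrow> real^'n \<Rightarrow> real \<Rightarrow> real^'n \<Rightarrow> real^'n \<Rightarrow> real^'n" where
  "D2x h x t u v = frechet_derivative (\<lambda>z. Dx h z t) (at x) u *v v"

definition Dt :: "((real^'n) \<times> real \<Rightarrow> real^'n) \<Rightarrow> real^'n \<Rightarrow> real \<Rightarrow> real^'n" where
  "Dt h x t = vector_derivative (\<lambda>s. h (x, s)) (at t)"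

definition singular_set ::
  "(real^'n) set \<Rightarrow> real \<Rightarrow> ((real^'n) \<times> real \<Rightarrow> real^'n) \<Rightarrow> ((real^'n) \<times> real) set" where
  "singular_set X T h =
     {(x, t). x \<in> X \<and> t \<in> {0<..<T} \<and> h (x, t) = 0 \<and> \<not> invertible (Dx h x t)}"

definition T1 :: "((real^'n) \<times> real \<Rightarrow> real^'n) \<Rightarrow> real^'n \<Rightarrow> real \<Rightarrow> bool" where
  "T1 h x t \<longleftrightarrow> dim (null_space (Dx h x t)) = 1"

definition T2 :: "((real^'n) \<times> real \<Rightarrow> real^'n) \<Rightarrow> real^'n \<Rightarrow> real \<Rightarrow> bool" where
  "T2 h x t \<longleftrightarrow>
     (\<forall>w. w \<noteq> 0 \<longrightarrow> w \<in> null_space (transpose (Dx h x t)) \<longrightarrow> Dt h x t \<bullet> w \<noteq> 0)"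

definition T3 :: "((real^'n) \<times> real \<Rightarrow> real^'n) \<Rightarrow> real^'n \<Rightarrow> real \<Rightarrow> bool" where
  "T3 h x t \<longleftrightarrow>
     (\<forall>v w. v \<noteq> 0 \<longrightarrow> v \<in> null_space (Dx h x t) \<longrightarrow>
            w \<noteq> 0 \<longrightarrow> w \<in> null_space (transpose (Dx h x t)) \<longrightarrow> D2x h x t v v \<bullet> w \<noteq> 0)"

definition transversality_conditions ::
  "(real^'n) set \<Rightarrow> real \<Rightarrow> ((real^'n) \<times> real \<Rightarrow> real^'n) \<Rightarrow> bool" where
  "transversality_conditions X T h \<longleftrightarrow>
     (\<forall>(x, t) \<in> singular_set X T h. T1 h x t \<and> T2 h x t \<and> T3 h x t)"

end

theory Submission
  imports Defs
begin

text \<open>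
  If the perturbed map is singular at \<open>(x, t)\<close>, then \<open>f(x,t) + y + K x = 0\<close> and
  \<open>(D\<^sub>xf(x,t) + K) v = 0\<close> for some \<open>v\<close> with \<open>v\<^sub>j = 1\<close> for some index \<open>j\<close>. These equations determine \<open>y\<close>
  and the \<open>j\<close>-th column of \<open>K\<close> from \<open>x\<close>, \<open>t\<close>, the other entries of \<open>v\<close> and the other columns of
  \<open>K\<close>, so all such \<open>(y, K)\<close> form the image of a \<open>C\<^sup>1\<close> map between spaces of the same dimension
  \<open>n + n\<^sup>2\<close>. With \<open>A = D\<^sub>xf(x,t) + K\<close>, this map is critical as soon as
  \<open>A x' + t' f\<^sub>t(x,t) = 0\<close>, \<open>D(D\<^sub>xf v)(x,t)[x', t'] + A u = 0\<close>, \<open>u\<^sub>j = 0\<close>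
  has a nonzero solution \<open>(x', t', u)\<close>, and linear algebra shows that this happens whenever one
  of (T1), (T2), (T3) fails. By Sard's theorem in equal dimensions the critical values are
  negligible; being a countable union of compact sets, they are then also meagre.
\<close>

subsection \<open>Critical values are negligible and meagre\<close>

text \<open>\<open>baby_Sard\<close> is stated for coordinate spaces whose index type is well-ordered.\<close>

typedef (overloaded) ('a::euclidean_space) basis_index = "{..<DIM('a)}"
  using DIM_positive by blast

instantiation basis_index :: (euclidean_space) "{finite, wellorder}"
begin

definition less_eq_basis_index :: "'a basis_index \<Rightarrow> 'a basis_index \<Rightarrow> bool" where
  "i \<le> j \<longleftrightarrow> Rep_basis_index i \<le> Rep_basis_index j"

definition less_basis_index :: "'a basis_index \<Rightarrow> 'a basis_index \<Rightarrow> bool" where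
  "i < j \<longleftrightarrow> Rep_basis_index i < Rep_basis_index j"

instance
proof
  show "finite (UNIV :: 'a basis_index set)"
    by (metis finite_imageI finite_lessThan type_definition.Abs_image
        type_definition_basis_index)
  fix P :: "'a basis_index \<Rightarrow> bool" and i
  assume step: "\<And>x. (\<And>y. y < x \<Longrightarrow> P y) \<Longrightarrow> P x"
  show "P i"
    by (induction i rule: measure_induct_rule[of Rep_basis_index])
      (auto intro: step simp: less_basis_index_def)
qed (auto simp: less_eq_basis_index_def less_basis_index_def Rep_basis_index_inject)

end

lemma CARD_basis_index: "CARD('a::euclidean_space basis_index) = DIM('a)"
  by (simp add: type_definition.card[OF type_definition_basis_index])

lemma negligible_linear_image_DIM_eq:
  fixes l :: "'a::euclidean_space \<Rightarrow> 'b::euclidean_space"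
  assumes "linear l" "DIM('a) = DIM('b)" "negligible S"
  shows "negligible (l ` S)"
  using assms
  by (intro negligible_differentiable_image_negligible linear_imp_differentiable_on) auto

text \<open>Conjugation with a linear isomorphism onto \<open>real^'a basis_index\<close> reduces
  this to \<open>baby_Sard\<close>. A nonzero vector in the kernel of \<open>g' x\<close> makes the
  conjugated square matrix non-injective, hence rank deficient. Linear maps between spaces of equal
  dimension carry negligible sets back.\<close>

theorem Sard_euclidean_space:
  fixes g :: "'a::euclidean_space \<Rightarrow> 'a"
  assumes der: "\<And>x. x \<in> S \<Longrightarrow> (g has_derivative g' x) (at x within S)"
    and crit: "\<And>x. x \<in> S \<Longrightarrow> \<exists>\<xi>. \<xi> \<noteq> 0 \<and> g' x \<xi> = 0"
  shows "negligible (g ` S)"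
proof -
  obtain \<phi> :: "'a \<Rightarrow> real^'a basis_index" and \<psi>
    where lin: "linear \<phi>" "linear \<psi>" and inv: "\<And>x. \<psi> (\<phi> x) = x" "\<And>y. \<phi> (\<psi> y) = y"
    by (rule isomorphisms_UNIV_UNIV[where ?'M = 'a and ?'N = "real^'a basis_index"])
      (auto simp: CARD_basis_index)
  have "negligible ((\<phi> \<circ> g \<circ> \<psi>) ` (\<phi> ` S))"
  proof (rule baby_Sard)
    fix y assume "y \<in> \<phi> ` S"
    then obtain x where x: "x \<in> S" "y = \<phi> x" by auto
    have img: "\<psi> ` \<phi> ` S = S"
      by (simp add: image_image inv)
    have d\<psi>: "(\<psi> has_derivative \<psi>) (at y within \<phi> ` S)"
      by (intro linear_imp_has_derivative lin)
    have dg: "(g has_derivative g' x) (at (\<psi> y) within \<psi> ` \<phi> ` S)"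
      using der x by (simp add: img inv)
    have D: "(\<phi> \<circ> g \<circ> \<psi> has_derivative \<phi> \<circ> g' x \<circ> \<psi>) (at y within \<phi> ` S)"
      using diff_chain_within[OF diff_chain_within[OF d\<psi> dg] linear_imp_has_derivative[OF lin(1)]]
      by (simp add: o_assoc)
    then show "(\<phi> \<circ> g \<circ> \<psi> has_derivative (\<phi> \<circ> g' (\<psi> y) \<circ> \<psi>)) (at y within \<phi> ` S)"
      by (simp add: x inv)
    obtain \<xi> where \<xi>: "\<xi> \<noteq> 0" "g' x \<xi> = 0" using crit x by blast
    have "\<phi> \<xi> \<noteq> 0"
      using \<xi> lin inv by (metis linear_0)
    moreover have "matrix (\<phi> \<circ> g' x \<circ> \<psi>) *v \<phi> \<xi> = 0"
      using has_derivative_linear[OF D] \<xi> inv linear_0[OF lin(1)]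
      by (simp add: matrix_works linear_matrix_vector_mul_eq)
    ultimately have "\<not> inj ((*v) (matrix (\<phi> \<circ> g' x \<circ> \<psi>)))"
      by (metis injD matrix_vector_mult_0_right)
    then show "rank (matrix (\<phi> \<circ> g' (\<psi> y) \<circ> \<psi>)) < CARD('a basis_index)"
      by (simp add: less_rank_noninjective x inv)
  qed auto
  then have "negligible (\<psi> ` (\<phi> \<circ> g \<circ> \<psi>) ` \<phi> ` S)"
    by (intro negligible_linear_image_DIM_eq[OF lin(2)]) (simp add: CARD_basis_index, assumption)
  then show ?thesis
    by (simp add: image_image inv)
qed

lemma compact_negligible_imp_nowhere_dense:
  fixes S :: "'a::euclidean_space set"
  assumes "compact S" "negligible S"
  shows "nowhere_dense S"
  unfolding nowhere_dense_def
  by (metis assms closure_eq compact_imp_closed interior_subset negligible_subset open_interior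
      open_not_negligible)

text \<open>Negligible sets need not be meagre, so topology has to enter. The open set
  \<open>U\<close> is a countable union of compact sets, hence so is its relatively closed subset
  \<open>Z\<close>. Each compact piece has a compact negligible image, which is closed with empty
  interior.\<close>

lemma meagre_image_if_negligible:
  fixes g :: "'a::euclidean_space \<Rightarrow> 'b::euclidean_space"
  assumes U: "open U" and g: "continuous_on U g"
    and Z: "closedin (top_of_set U) Z" and neg: "negligible (g ` Z)"
  shows "meagre (g ` Z)"
proof -
  obtain C where C: "\<And>n::nat. compact (C n)" "\<And>n. C n \<subseteq> U" "\<Union>(range C) = U"
    using open_Union_compact_subsets[OF U] by metis
  obtain D where D: "closed D" "Z = U \<inter> D"
    using Z by (auto simp: closedin_closed)
  have "nowhere_dense (g ` (C n \<inter> D))" for n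
  proof (rule compact_negligible_imp_nowhere_dense)
    show "compact (g ` (C n \<inter> D))"
      using C D g by (intro compact_continuous_image compact_Int_closed)
        (auto intro: continuous_on_subset)
    show "negligible (g ` (C n \<inter> D))"
      by (rule negligible_subset[OF neg]) (use C D in auto)
  qed
  moreover have "g ` Z \<subseteq> (\<Union>n. g ` (C n \<inter> D))"
    using C(3) D by auto
  ultimately show ?thesis
    unfolding meagre_def by (intro exI[of _ "range (\<lambda>n. g ` (C n \<inter> D))"]) auto
qed

lemma meagre_UN:
  assumes "countable I" "\<And>i. i \<in> I \<Longrightarrow> meagre (A i)"
  shows "meagre (\<Union>i\<in>I. A i)"
proof -
  obtain \<A> where "\<And>i. i \<in> I \<Longrightarrow> countable (\<A> i) \<and> (\<forall>B\<in>\<A> i. nowhere_dense B) \<and> A i \<subseteq> \<Union>(\<A> i)"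
    using assms(2) unfolding meagre_def by metis
  then show ?thesis
    using assms(1) unfolding meagre_def
    by (intro exI[of _ "\<Union>i\<in>I. \<A> i"]) fastforce
qed

subsection \<open>Failure of transversality in terms of linear algebra\<close>

text \<open>The Fredholm alternative for a one-dimensional kernel: the range lies in the hyperplane
  orthogonal to \<open>w\<close>, and rank-nullity shows that both have dimension n - 1.\<close>

lemma range_eq_orthogonal_left_null_vector:
  fixes A :: "real^'n^'n"
  assumes dim: "dim (null_space A) = 1" and w: "w \<noteq> 0" "w \<in> null_space (transpose A)"
  shows "range ((*v) A) = {b. w \<bullet> b = 0}"
proof (rule subspace_dim_equal)
  show "subspace (range ((*v) A))"
    by (simp add: linear_subspace_image matrix_vector_mul_linear)
  show "subspace {b. w \<bullet> b = 0}"
    by (rule subspace_hyperplane)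
  show "range ((*v) A) \<subseteq> {b. w \<bullet> b = 0}"
  proof clarify
    fix x
    have "w \<bullet> (A *v x) = (transpose A *v w) \<bullet> x"
      by (simp add: dot_lmul_matrix[symmetric])
    then show "w \<bullet> (A *v x) = 0"
      using w by (simp add: null_space_def)
  qed
  \<comment> \<open>Rank-nullity is obtained from the row space: its orthogonal complement is the
    null space, and row rank equals column rank.\<close>
  have "dim {y \<in> UNIV. \<forall>x \<in> span (rows A). orthogonal x y} + dim (span (rows A)) = CARD('n)"
    using dim_subspace_orthogonal_to_vectors[of "span (rows A)" UNIV] by simp
  moreover have "{y \<in> UNIV. \<forall>x \<in> span (rows A). orthogonal x y} = null_space A"
  proof -
    have "(\<forall>x \<in> span (rows A). orthogonal x y) \<longleftrightarrow> A *v y = 0" for y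
    proof -
      have "rows A = range (\<lambda>i. A $ i)"
        by (auto simp: rows_def row_def)
      then have "A *v y = 0 \<longleftrightarrow> (\<forall>x \<in> rows A. orthogonal y x)"
        by (auto simp: vec_eq_iff matrix_vector_mul_component orthogonal_def inner_commute)
      then show ?thesis
        by (metis orthogonal_commute orthogonal_to_span span_base)
    qed
    then show ?thesis by (simp add: null_space_def)
  qed
  ultimately have "dim (null_space A) + dim (range ((*v) A)) = CARD('n)"
    by (simp add: rank_dim_range[symmetric] row_rank_def)
  then show "dim {b. w \<bullet> b = 0} \<le> dim (range ((*v) A))"
    using dim w by (simp add: dim_hyperplane null_space_def)
qed

text \<open>Used in contrapositive form: if (T1) fails, some null vector is not a multiple of the
  given one.\<close>

lemma dim_null_space_eq_1I:
  assumes v: "v \<in> null_space A" "v \<noteq> 0" and "\<And>u. u \<in> null_space A \<Longrightarrow> \<exists>c. u = c *\<^sub>R v"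
  shows "dim (null_space A) = 1"
proof -
  have "null_space A = span {v}"
  proof
    show "null_space A \<subseteq> span {v}"
      using assms(3) by (auto simp: span_singleton)
    show "span {v} \<subseteq> null_space A"
      using v(1) by (auto simp: span_singleton null_space_def matrix_vector_mult_scaleR)
  qed
  then show ?thesis
    using v(2) by simp
qed

lemma parallel_null_vectors:
  assumes "dim (null_space A) = 1" "u \<noteq> 0" "u \<in> null_space A" "v \<in> null_space A"
  obtains c where "v = c *\<^sub>R u"
proof -
  have "null_space A \<subseteq> span {u}"
    by (rule card_ge_dim_independent) (use assms in auto)
  then show ?thesis
    using assms(4) that by (auto simp: span_singleton)
qed

text \<open>In the application \<open>a\<close> is the time derivative and \<open>H\<close> the
  derivative of \<open>D_x f [v]\<close> in \<open>(x, t)\<close>. If (T1) fails, a second kernel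
  direction serves as \<open>u\<close>, with \<open>x = 0\<close> and \<open>t = 0\<close>. If (T3)
  fails, \<open>x = v\<close> and \<open>t = 0\<close> work. If only (T2) fails,
  \<open>t = 1\<close> works with a suitable solution \<open>x\<close> of \<open>A x = - a\<close>.
  In the last two cases \<open>u\<close> comes from the Fredholm alternative.\<close>

lemma singular_linearization_if_degenerate:
  fixes A :: "real^'n^'n" and H :: "(real^'n) \<times> real \<Rightarrow> real^'n"
  assumes v: "A *v v = 0" "v $ j = 1" and H: "linear H"
    and bad: "dim (null_space A) \<noteq> 1 \<or>
      (\<exists>w. w \<noteq> 0 \<and> w \<in> null_space (transpose A) \<and> (a \<bullet> w = 0 \<or> H (v, 0) \<bullet> w = 0))"
  obtains x t u where "(x, t, u) \<noteq> 0" "u $ j = 0" "A *v x + t *\<^sub>R a = 0" "H (x, t) + A *v u = 0"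
proof -
  have v0: "v \<noteq> 0" using v(2) by auto
  show ?thesis
  proof (cases "dim (null_space A) = 1")
    case False
    then obtain u where u: "u \<in> null_space A" "\<And>c. u \<noteq> c *\<^sub>R v"
      using dim_null_space_eq_1I[of v A] v v0 by (auto simp: null_space_def)
    show ?thesis
    proof (rule that[of 0 0 "u - (u $ j) *\<^sub>R v"])
      show "(0, 0, u - (u $ j) *\<^sub>R v) \<noteq> 0" using u(2) by (simp add: zero_prod_def)
      show "H (0, 0) + A *v (u - (u $ j) *\<^sub>R v) = 0"
        using u v H linear_0[OF H]
        by (simp add: null_space_def zero_prod_def matrix_vector_mult_diff_distrib matrix_vector_mult_scaleR)
    qed (use v in auto)
  next
    case dim: True
    then obtain w where w: "w \<noteq> 0" "w \<in> null_space (transpose A)"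
      and aH: "a \<bullet> w = 0 \<or> H (v, 0) \<bullet> w = 0"
      using bad by auto
    have solve: "\<exists>x. A *v x = - b" if "b \<bullet> w = 0" for b
    proof -
      have "- b \<in> range ((*v) A)"
        using range_eq_orthogonal_left_null_vector[OF dim w] that by (simp add: inner_commute)
      then show ?thesis by (metis rangeE)
    qed
    \<comment> \<open>Since \<open>A v = 0\<close> and \<open>v $ j = 1\<close>, subtracting a
      multiple of \<open>v\<close> clears the \<open>j\<close>-th entry of a solution without
      changing its image.\<close>
    have solve_j: "\<exists>u. u $ j = 0 \<and> b + A *v u = 0" if b: "b \<bullet> w = 0" for b
    proof -
      obtain x where "A *v x = - b" using solve[OF b] by blast
      then show ?thesis
        using v by (intro exI[of _ "x - (x $ j) *\<^sub>R v"])
          (simp add: matrix_vector_mult_diff_distrib matrix_vector_mult_scaleR)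
    qed
    show ?thesis
    proof (cases "H (v, 0) \<bullet> w = 0")
      case True
      then obtain u where "u $ j = 0" "H (v, 0) + A *v u = 0"
        using solve_j by blast
      then show ?thesis
        using that[of v 0 u] v v0 by (simp add: zero_prod_def)
    next
      case False
      then obtain x where x: "A *v x = - a"
        using aH solve by blast
      \<comment> \<open>Moving \<open>x\<close> along the kernel vector \<open>v\<close> preserves
        \<open>A x = - a\<close>. This \<open>c\<close> makes the right-hand side of the second
        equation orthogonal to \<open>w\<close>, so that it becomes solvable for
        \<open>u\<close>.\<close>
      define c where "c = (H (x, 1) \<bullet> w) / (H (v, 0) \<bullet> w)"
      have "H (x - c *\<^sub>R v, 1) = H (x, 1) - c *\<^sub>R H (v, 0)"
        using linear_diff[OF H, of "(x, 1)" "c *\<^sub>R (v, 0)"] linear_scale[OF H, of c "(v, 0)"] by simp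
      then have "H (x - c *\<^sub>R v, 1) \<bullet> w = 0"
        using False by (simp add: c_def inner_diff_left)
      then obtain u where "u $ j = 0" "H (x - c *\<^sub>R v, 1) + A *v u = 0"
        using solve_j by blast
      then show ?thesis
        using that[of "x - c *\<^sub>R v" 1 u] v x
        by (simp add: zero_prod_def matrix_vector_mult_diff_distrib matrix_vector_mult_scaleR)
    qed
  qed
qed

subsection \<open>Maps of class \<open>C\<^sup>2\<close>\<close>

text \<open>Linearity in the second argument expands \<open>F q\<close> over the finite basis, so
  differentiability for each fixed direction yields joint differentiability by the product rule.
  Uniqueness of derivatives transfers the linearity to \<open>D\<close>.\<close>

lemma has_derivative_apply_pair:
  fixes F :: "'a::euclidean_space \<Rightarrow> 'b::euclidean_space \<Rightarrow> 'c::euclidean_space"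
  assumes S: "open S" "p \<in> S" and lin: "\<And>q. q \<in> S \<Longrightarrow> linear (F q)"
    and der: "\<And>\<zeta>. ((\<lambda>q. F q \<zeta>) has_derivative D \<zeta>) (at p)"
  shows "((\<lambda>(q, \<zeta>). F q \<zeta>) has_derivative (\<lambda>(\<eta>, \<theta>). D \<zeta> \<eta> + F p \<theta>)) (at (p, \<zeta>))"
    and "D \<zeta> \<eta> = (\<Sum>b\<in>Basis. (\<zeta> \<bullet> b) *\<^sub>R D b \<eta>)"
proof -
  have F: "F q \<theta> = (\<Sum>b\<in>Basis. (\<theta> \<bullet> b) *\<^sub>R F q b)" if "q \<in> S" for q \<theta>
    using linear_sum[OF lin[OF that], of "\<lambda>b. (\<theta> \<bullet> b) *\<^sub>R b" Basis]
    by (simp add: linear_scale[OF lin[OF that]] euclidean_representation)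
  have "((\<lambda>q. F q \<zeta>) has_derivative (\<lambda>\<eta>. \<Sum>b\<in>Basis. (\<zeta> \<bullet> b) *\<^sub>R D b \<eta>)) (at p)"
    by (rule has_derivative_transform_within_open[OF _ S, where f = "\<lambda>q. \<Sum>b\<in>Basis. (\<zeta> \<bullet> b) *\<^sub>R F q b"])
      (auto intro!: derivative_eq_intros der simp: F[symmetric])
  from has_derivative_unique[OF der this]
  show D: "D \<zeta> \<eta> = (\<Sum>b\<in>Basis. (\<zeta> \<bullet> b) *\<^sub>R D b \<eta>)" for \<eta>
    by (rule fun_cong)
  have der': "((\<lambda>z. F (fst z) b) has_derivative (\<lambda>h. D b (fst h))) (at (p, \<zeta>))" for b
    by (rule has_derivative_compose[where f = fst]) (auto intro!: derivative_eq_intros der)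
  have "((\<lambda>z. \<Sum>b\<in>Basis. (snd z \<bullet> b) *\<^sub>R F (fst z) b) has_derivative
      (\<lambda>h. \<Sum>b\<in>Basis. (\<zeta> \<bullet> b) *\<^sub>R D b (fst h) + (snd h \<bullet> b) *\<^sub>R F p b)) (at (p, \<zeta>))"
    by (auto intro!: derivative_eq_intros der')
  also have "(\<lambda>h. \<Sum>b\<in>Basis. (\<zeta> \<bullet> b) *\<^sub>R D b (fst h) + (snd h \<bullet> b) *\<^sub>R F p b) =
      (\<lambda>(\<eta>, \<theta>). D \<zeta> \<eta> + F p \<theta>)"
    by (auto simp: fun_eq_iff sum.distrib D[symmetric] F[OF S(2), symmetric])
  finally show "((\<lambda>(q, \<zeta>). F q \<zeta>) has_derivative (\<lambda>(\<eta>, \<theta>). D \<zeta> \<eta> + F p \<theta>)) (at (p, \<zeta>))"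
    by (rule has_derivative_transform_within_open[where s = "S \<times> UNIV"])
      (use S F in \<open>auto intro: open_Times\<close>)
qed

lemma Ck_on_frechet_derivative:
  assumes "Ck_on (Suc k) f S" "p \<in> S"
  shows "(f has_derivative frechet_derivative f (at p)) (at p)"
  using assms by (simp add: frechet_derivative_works)

text \<open>\<open>F p\<close> stands for the derivative of \<open>f\<close> at \<open>p\<close>,
  and \<open>G p \<zeta> \<eta>\<close> for the derivative of \<open>F q \<zeta>\<close> with
  respect to \<open>q\<close> at \<open>p\<close> in direction \<open>\<eta>\<close>. Working
  direction by direction matches \<open>Ck_on\<close>.\<close>

locale C2_map =
  fixes f :: "(real^'n) \<times> real \<Rightarrow> real^'n" and S :: "((real^'n) \<times> real) set"
    and F :: "(real^'n) \<times> real \<Rightarrow> (real^'n) \<times> real \<Rightarrow> real^'n"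
    and G :: "(real^'n) \<times> real \<Rightarrow> (real^'n) \<times> real \<Rightarrow> (real^'n) \<times> real \<Rightarrow> real^'n"
  assumes open_S: "open S"
    and has_F: "p \<in> S \<Longrightarrow> (f has_derivative F p) (at p)"
    and has_G: "p \<in> S \<Longrightarrow> ((\<lambda>q. F q \<zeta>) has_derivative G p \<zeta>) (at p)"
    and cont_G: "continuous_on S (\<lambda>p. G p \<zeta> \<eta>)"
begin

lemma linear_F: "p \<in> S \<Longrightarrow> linear (F p)"
  using has_F by (rule has_derivative_linear)

lemma linear_G: "p \<in> S \<Longrightarrow> linear (G p \<zeta>)"
  using has_G by (rule has_derivative_linear)

lemma has_derivative_F_pair:
  assumes "p \<in> S"
  shows "((\<lambda>(q, \<zeta>). F q \<zeta>) has_derivative (\<lambda>(\<eta>, \<theta>). G p \<zeta> \<eta> + F p \<theta>)) (at (p, \<zeta>))"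
  using has_derivative_apply_pair(1)[OF open_S assms linear_F has_G[OF assms]] .

lemma has_derivative_F:
  assumes "(a has_derivative a') (at z)" "(b has_derivative b') (at z)" "a z \<in> S"
  shows "((\<lambda>z. F (a z) (b z)) has_derivative (\<lambda>h. G (a z) (b z) (a' h) + F (a z) (b' h))) (at z)"
  using has_derivative_compose[OF has_derivative_Pair[OF assms(1,2)]
      has_derivative_F_pair[OF assms(3)]]
  by (simp add: case_prod_beta)

lemma has_derivative_f:
  assumes "(a has_derivative a') (at z)" "a z \<in> S"
  shows "((\<lambda>z. f (a z)) has_derivative (\<lambda>h. F (a z) (a' h))) (at z)"
  using has_derivative_compose[OF assms(1) has_F[OF assms(2)]] .

lemma continuous_on_F:
  assumes "continuous_on A a" "continuous_on A b" "a ` A \<subseteq> S"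
  shows "continuous_on A (\<lambda>z. F (a z) (b z))"
proof -
  have "continuous_on (S \<times> UNIV) (\<lambda>(q, \<zeta>). F q \<zeta>)"
    by (rule continuous_at_imp_continuous_on)
      (auto intro!: has_derivative_continuous[OF has_derivative_F_pair])
  from continuous_on_compose2[OF this continuous_on_Pair[OF assms(1,2)]] assms(3)
  show ?thesis by auto
qed

text \<open>Bilinearity reduces joint continuity of \<open>G\<close> in the point and both
  directions to \<open>cont_G\<close> at pairs of basis vectors.\<close>

lemma G_expand:
  assumes "p \<in> S"
  shows "G p \<zeta> \<eta> = (\<Sum>b\<in>Basis. \<Sum>c\<in>Basis. (\<zeta> \<bullet> b) *\<^sub>R (\<eta> \<bullet> c) *\<^sub>R G p b c)"
proof -
  have "G p b \<eta> = (\<Sum>c\<in>Basis. (\<eta> \<bullet> c) *\<^sub>R G p b c)" for b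
    using linear_sum[OF linear_G[OF assms], of _ "\<lambda>c. (\<eta> \<bullet> c) *\<^sub>R c" Basis]
    by (simp add: linear_scale[OF linear_G[OF assms]] euclidean_representation)
  then show ?thesis
    using has_derivative_apply_pair(2)[OF open_S assms linear_F has_G[OF assms], of \<zeta> \<eta>]
    by (simp add: scaleR_sum_right)
qed

lemma continuous_on_G:
  assumes "continuous_on A a" "continuous_on A b" "continuous_on A c" "a ` A \<subseteq> S"
  shows "continuous_on A (\<lambda>z. G (a z) (b z) (c z))"
proof -
  have "continuous_on A (\<lambda>z. G (a z) \<zeta> \<eta>)" for \<zeta> \<eta>
    using continuous_on_compose2[OF cont_G assms(1,4)] .
  then have "continuous_on A (\<lambda>z. \<Sum>\<beta>\<in>Basis. \<Sum>\<gamma>\<in>Basis. (b z \<bullet> \<beta>) *\<^sub>R (c z \<bullet> \<gamma>) *\<^sub>R G (a z) \<beta> \<gamma>)"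
    by (intro continuous_intros assms)
  then show ?thesis
    by (rule continuous_on_eq) (use assms(4) in \<open>blast intro: G_expand[symmetric]\<close>)
qed

end

subsection \<open>Parametrization of the singular perturbations\<close>

text \<open>
  A parameter \<open>z = (u, B)\<close> packs the data \<open>(x, t, v, K)\<close>: the redundant entry \<open>u\<^sub>j\<close> (since \<open>v\<^sub>j = 1\<close>)
  stores \<open>t\<close>, and the redundant \<open>j\<close>-th column of \<open>B\<close> stores \<open>x\<close>. This gives source and target of
  the parametrization the same type.
\<close>

definition base_point :: "'n \<Rightarrow> (real^'n) \<times> (real^'n^'n) \<Rightarrow> (real^'n) \<times> real" where
  "base_point j z = (column j (snd z), fst z $ j)"

definition zero_entry :: "'n \<Rightarrow> real^'n \<Rightarrow> real^'n" where
  "zero_entry j u = (\<chi> k. if k = j then 0 else u $ k)"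

definition kernel_vector :: "'n \<Rightarrow> real^'n \<Rightarrow> real^'n" where
  "kernel_vector j u = axis j 1 + zero_entry j u"

definition zero_column :: "'n \<Rightarrow> real^'n^'n \<Rightarrow> real^'n^'n" where
  "zero_column j B = (\<chi> i k. if k = j then 0 else B $ i $ k)"

text \<open>The rank-one matrix \<open>c e_j^T\<close>.\<close>

definition column_matrix :: "'n \<Rightarrow> real^'n \<Rightarrow> real^'n^'n" where
  "column_matrix j c = (\<chi> i k. if k = j then c $ i else 0)"

lemma linear_base_point: "linear (base_point j)"
  by (rule linearI) (auto simp: base_point_def column_def vec_eq_iff)

lemma linear_zero_entry: "linear (zero_entry j)"
  by (rule linearI) (auto simp: zero_entry_def vec_eq_iff)

lemma linear_zero_column: "linear (zero_column j)"
  by (rule linearI) (auto simp: zero_column_def vec_eq_iff)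

lemma linear_column_matrix: "linear (column_matrix j)"
  by (rule linearI) (auto simp: column_matrix_def vec_eq_iff)

lemma column_matrix_mult: "column_matrix j c *v x = (x $ j) *\<^sub>R c"
  by (auto simp: column_matrix_def matrix_vector_mult_def vec_eq_iff if_distrib if_distribR cong: if_cong)

text \<open>Allows a matrix field to be differentiated column by column.\<close>

lemma matrix_eq_sum_column_matrix: "matrix f = (\<Sum>k\<in>UNIV. column_matrix k (f (axis k 1)))"
  by (simp add: matrix_def column_matrix_def vec_eq_iff)

lemma bounded_bilinear_matrix_vector_mult:
  "bounded_bilinear ((*v) :: real^'n^'m \<Rightarrow> real^'n \<Rightarrow> real^'m)"
  unfolding bilinear_conv_bounded_bilinear[symmetric] bilinear_def
  by (auto intro!: linearI simp: algebra_simps matrix_vector_mult_scaleR scaleR_matrix_vector_assoc)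

lemmas linear_compose_has_derivative =
  bounded_linear.has_derivative[OF linear_conv_bounded_linear[THEN iffD1]]

context C2_map
begin

text \<open>Because \<open>v $ j = 1\<close>, the \<open>j\<close>-th column of \<open>K\<close>
  enters \<open>K v\<close> with coefficient 1, so \<open>(D_x f + K) v = 0\<close> can be solved
  for it. Once \<open>K\<close> is complete, \<open>f + y + K x = 0\<close> determines
  \<open>y\<close>.\<close>

definition annihilating_column :: "'n \<Rightarrow> (real^'n) \<times> (real^'n^'n) \<Rightarrow> real^'n" where
  "annihilating_column j z = - F (base_point j z) (kernel_vector j (fst z), 0)
     - zero_column j (snd z) *v kernel_vector j (fst z)"

definition annihilating_matrix :: "'n \<Rightarrow> (real^'n) \<times> (real^'n^'n) \<Rightarrow> real^'n^'n" where
  "annihilating_matrix j z = zero_column j (snd z) + column_matrix j (annihilating_column j z)"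

definition singular_parameters :: "'n \<Rightarrow> (real^'n) \<times> (real^'n^'n) \<Rightarrow> (real^'n) \<times> (real^'n^'n)" where
  "singular_parameters j z =
     (- f (base_point j z) - annihilating_matrix j z *v fst (base_point j z), annihilating_matrix j z)"

text \<open>The derivative of \<open>(x, t, v) \<mapsto> (f(x,t) + y + K x, D\<^sub>xf(x,t) v + K v, v\<^sub>j)\<close>, with \<open>y\<close> and \<open>K\<close> fixed.\<close>

definition linearization ::
  "'n \<Rightarrow> (real^'n) \<times> (real^'n^'n) \<Rightarrow> (real^'n) \<times> real \<times> (real^'n) \<Rightarrow> (real^'n) \<times> (real^'n) \<times> real" where
  "linearization j z = (\<lambda>(x, t, u).
     (F (base_point j z) (x, t) + annihilating_matrix j z *v x,
      G (base_point j z) (kernel_vector j (fst z), 0) (x, t)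
        + (F (base_point j z) (u, 0) + annihilating_matrix j z *v u),
      u $ j))"

text \<open>Nonzero solutions are normalized to the unit sphere, whose compactness makes this set
  relatively closed in the parameter domain.\<close>

definition degenerate :: "'n \<Rightarrow> ((real^'n) \<times> (real^'n^'n)) set" where
  "degenerate j = {z. base_point j z \<in> S \<and> (\<exists>\<xi>\<in>sphere 0 1. linearization j z \<xi> = 0)}"

lemma has_derivative_annihilating_column:
  assumes "base_point j z \<in> S"
  shows "(annihilating_column j has_derivative
    (\<lambda>h. - (G (base_point j z) (kernel_vector j (fst z), 0) (base_point j h)
            + F (base_point j z) (zero_entry j (fst h), 0))
         - (zero_column j (snd z) *v zero_entry j (fst h)
            + zero_column j (snd h) *v kernel_vector j (fst z)))) (at z)"
proof -
  have base: "(base_point j has_derivative base_point j) (at z)"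
    by (rule linear_imp_has_derivative[OF linear_base_point])
  have kv: "((\<lambda>z. kernel_vector j (fst z)) has_derivative (\<lambda>h. zero_entry j (fst h))) (at z)"
    unfolding kernel_vector_def
    by (auto intro!: derivative_eq_intros linear_compose_has_derivative[OF linear_zero_entry])
  have kv0: "((\<lambda>z. (kernel_vector j (fst z), 0::real)) has_derivative (\<lambda>h. (zero_entry j (fst h), 0))) (at z)"
    by (intro has_derivative_Pair kv has_derivative_const)
  have zc: "((\<lambda>z. zero_column j (snd z)) has_derivative (\<lambda>h. zero_column j (snd h))) (at z)"
    by (intro linear_compose_has_derivative[OF linear_zero_column] has_derivative_snd has_derivative_ident)
  show ?thesis
    unfolding annihilating_column_def[abs_def]
    by (intro has_derivative_diff has_derivative_minus has_derivative_F[OF base kv0 assms]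
        bounded_bilinear.FDERIV[OF bounded_bilinear_matrix_vector_mult zc kv])
qed

text \<open>The direction fed to \<open>D\<close> packs \<open>(x, t, u)\<close> and leaves the free
  columns of \<open>K\<close> fixed. The second equation of the linearization then makes the
  variation of the solved column vanish, hence that of \<open>K\<close>; the first does the same for
  \<open>y\<close>.\<close>

lemma singular_parameters_has_derivative:
  assumes z: "base_point j z \<in> S"
  obtains D where "(singular_parameters j has_derivative D) (at z)"
    and "\<And>x t u. linearization j z (x, t, u) = 0 \<Longrightarrow>
      D (t *\<^sub>R axis j 1 + u, column_matrix j x) = 0"
proof -
  define nc' where "nc' = (\<lambda>h. - (G (base_point j z) (kernel_vector j (fst z), 0) (base_point j h)
            + F (base_point j z) (zero_entry j (fst h), 0))
         - (zero_column j (snd z) *v zero_entry j (fst h)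
            + zero_column j (snd h) *v kernel_vector j (fst z)))"
  define K' where "K' = (\<lambda>h. zero_column j (snd h) + column_matrix j (nc' h))"
  define D where "D = (\<lambda>h. (- F (base_point j z) (base_point j h)
    - (annihilating_matrix j z *v fst (base_point j h) + K' h *v fst (base_point j z)), K' h))"
  have base: "(base_point j has_derivative base_point j) (at z)"
    by (rule linear_imp_has_derivative[OF linear_base_point])
  have K: "(annihilating_matrix j has_derivative K') (at z)"
    unfolding annihilating_matrix_def[abs_def] K'_def nc'_def
    by (intro has_derivative_add linear_compose_has_derivative[OF linear_zero_column]
        linear_compose_has_derivative[OF linear_column_matrix] has_derivative_annihilating_column[OF z]
        has_derivative_snd has_derivative_ident)
  have "(singular_parameters j has_derivative D) (at z)"
    unfolding singular_parameters_def[abs_def] D_def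
    by (intro has_derivative_Pair has_derivative_diff has_derivative_minus K
        has_derivative_f[OF base z] bounded_bilinear.FDERIV[OF bounded_bilinear_matrix_vector_mult]
        has_derivative_fst base)
  moreover have "D (t *\<^sub>R axis j 1 + u, column_matrix j x) = 0"
    if lin: "linearization j z (x, t, u) = 0" for x t u
  proof -
    let ?h = "(t *\<^sub>R axis j 1 + u, column_matrix j x)"
    have u: "u $ j = 0"
      and eq1: "F (base_point j z) (x, t) + annihilating_matrix j z *v x = 0"
      and eq2: "G (base_point j z) (kernel_vector j (fst z), 0) (x, t)
        + (F (base_point j z) (u, 0) + annihilating_matrix j z *v u) = 0"
      using lin by (auto simp: linearization_def zero_prod_def)
    have h: "base_point j ?h = (x, t)" "zero_entry j (t *\<^sub>R axis j 1 + u) = u"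
      "zero_column j (column_matrix j x) = 0"
      using u by (auto simp: base_point_def column_def column_matrix_def zero_entry_def
          zero_column_def vec_eq_iff axis_def)
    \<comment> \<open>The solved column is invisible to \<open>u\<close>, because
      \<open>u $ j = 0\<close>.\<close>
    have "annihilating_matrix j z *v u = zero_column j (snd z) *v u"
      using u by (simp add: annihilating_matrix_def algebra_simps column_matrix_mult)
    then have "nc' ?h = - (G (base_point j z) (kernel_vector j (fst z), 0) (x, t)
        + (F (base_point j z) (u, 0) + annihilating_matrix j z *v u))"
      by (simp add: nc'_def h)
    then have "K' ?h = 0"
      by (simp add: K'_def h eq2 linear_0[OF linear_column_matrix])
    moreover have "- F (base_point j z) (x, t) - annihilating_matrix j z *v x = 0"
      using eq1 by (simp add: neg_eq_iff_add_eq_0)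
    ultimately show ?thesis
      by (simp add: D_def h zero_prod_def)
  qed
  ultimately show ?thesis by (rule that)
qed

lemma linear_linearization:
  assumes "base_point j z \<in> S"
  shows "linear (linearization j z)"
proof -
  have L: "L (x + x', t + t') = L (x, t) + L (x', t')" "L (x + x', 0) = L (x, 0) + L (x', 0)"
    "L (r *\<^sub>R x, r * t) = r *\<^sub>R L (x, t)" "L (r *\<^sub>R x, 0) = r *\<^sub>R L (x, 0)"
    if "linear L" for L :: "(real^'n) \<times> real \<Rightarrow> real^'n" and x x' t t' r
    using linear_add[OF that, of "(x, t)" "(x', t')"] linear_add[OF that, of "(x, 0)" "(x', 0)"]
      linear_scale[OF that, of r "(x, t)"] linear_scale[OF that, of r "(x, 0)"] by simp_all
  show ?thesis
    by (rule linearI) (auto simp: linearization_def L[OF linear_F[OF assms]]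
        L[OF linear_G[OF assms]] algebra_simps matrix_vector_mult_scaleR)
qed

section \<open>Smallness of the set of critical values\<close>

lemma open_parameter_domain: "open {z. base_point j z \<in> S}"
  using open_vimage[OF open_S linear_continuous_on[OF linear_conv_bounded_linear[THEN iffD1, OF linear_base_point]]]
  by (simp add: vimage_def)

lemma continuous_on_singular_parameters:
  "continuous_on {z. base_point j z \<in> S} (singular_parameters j)"
proof (intro continuous_at_imp_continuous_on ballI)
  fix z assume "z \<in> {z. base_point j z \<in> S}"
  then have "base_point j z \<in> S" by simp
  then obtain D where "(singular_parameters j has_derivative D) (at z)"
    by (rule singular_parameters_has_derivative)
  then show "isCont (singular_parameters j) z"
    by (rule has_derivative_continuous)
qed

lemma negligible_degenerate: "negligible (singular_parameters j ` degenerate j)"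
proof (rule Sard_euclidean_space)
  fix z assume "z \<in> degenerate j"
  then obtain x t u where z: "base_point j z \<in> S" and n: "norm (x, t, u) = 1"
    and lin: "linearization j z (x, t, u) = 0"
    by (auto simp: degenerate_def)
  obtain D where D: "(singular_parameters j has_derivative D) (at z)"
    and 0: "D (t *\<^sub>R axis j 1 + u, column_matrix j x) = 0"
    using singular_parameters_has_derivative[OF z] lin by metis
  have D_eq: "D = frechet_derivative (singular_parameters j) (at z)"
    by (rule frechet_derivative_at[OF D])
  show "(singular_parameters j has_derivative frechet_derivative (singular_parameters j) (at z))
      (at z within degenerate j)"
    using D unfolding D_eq by (rule has_derivative_at_withinI)
  have uj: "u $ j = 0"
    using lin by (auto simp: linearization_def zero_prod_def)
  \<comment> \<open>The packing loses nothing: as \<open>u $ j = 0\<close>, the \<open>j\<close>-th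
    entry returns \<open>t\<close>, the other entries return \<open>u\<close>, and the
    \<open>j\<close>-th column returns \<open>x\<close>.\<close>
  have "(t *\<^sub>R axis j 1 + u, column_matrix j x) \<noteq> 0"
  proof
    assume eq: "(t *\<^sub>R axis j 1 + u, column_matrix j x) = 0"
    have t: "t = 0"
      using eq uj by (auto simp: zero_prod_def vec_eq_iff axis_def dest: spec[of _ j])
    have "x = 0"
      using eq by (auto simp: zero_prod_def vec_eq_iff column_matrix_def split: if_splits)
    moreover have "u = 0"
      using eq t by (simp add: zero_prod_def)
    ultimately show False
      using n t by (simp add: norm_prod_def)
  qed
  then show "\<exists>\<xi>. \<xi> \<noteq> 0 \<and> frechet_derivative (singular_parameters j) (at z) \<xi> = 0"
    using 0 D_eq by blast
qed

text \<open>The pairs of a unit vector and a parameter at which the linearization vanishes form a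
  relatively closed set by joint continuity; projecting along the compact sphere preserves
  closedness.\<close>

lemma closedin_degenerate: "closedin (top_of_set {z. base_point j z \<in> S}) (degenerate j)"
proof -
  let ?U = "{z. base_point j z \<in> S}" and ?B = "sphere (0 :: (real^'n) \<times> real \<times> (real^'n)) 1"
  have lin: "continuous_on A (\<lambda>x. l (g x))" if "linear l" "continuous_on A g"
    for l :: "'c::euclidean_space \<Rightarrow> 'd::euclidean_space" and A :: "'e::topological_space set" and g
    using continuous_on_compose2[OF linear_continuous_on[OF linear_conv_bounded_linear[THEN iffD1, OF that(1)]] that(2)]
    by blast
  have mult: "continuous_on A (\<lambda>x. M x *v g x)" if "continuous_on A M" "continuous_on A g"
    for M :: "'e::topological_space \<Rightarrow> real^'n^'n" and A g
    by (rule bounded_bilinear.continuous_on[OF bounded_bilinear_matrix_vector_mult that])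
  have kv: "continuous_on A (\<lambda>x. kernel_vector j (g x))" if "continuous_on A g"
    for A :: "'e::topological_space set" and g
    unfolding kernel_vector_def by (intro continuous_intros lin[OF linear_zero_entry] that)
  have "continuous_on (?B \<times> ?U) (\<lambda>(\<xi>, z). linearization j z \<xi>)"
    unfolding linearization_def annihilating_matrix_def annihilating_column_def case_prod_beta
    by (intro continuous_intros continuous_on_F continuous_on_G mult kv
        lin[OF linear_base_point] lin[OF linear_zero_column] lin[OF linear_column_matrix]) auto
  then have "closedin (top_of_set (?B \<times> ?U)) {p \<in> ?B \<times> ?U. (\<lambda>(\<xi>, z). linearization j z \<xi>) p = 0}"
    by (rule continuous_closedin_preimage_constant)
  from closedin_compact_projection[OF compact_sphere this]
  show ?thesis
    by (rule back_subst[of "closedin _"]) (force simp: degenerate_def image_iff)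
qed

lemma meagre_degenerate: "meagre (singular_parameters j ` degenerate j)"
  by (rule meagre_image_if_negligible[OF open_parameter_domain continuous_on_singular_parameters
        closedin_degenerate negligible_degenerate])

section \<open>Derivatives of the perturbed map\<close>

lemma has_derivative_perturbed:
  assumes "(x, t) \<in> S"
  shows "((\<lambda>z. f (z, t) + y + K *v z) has_derivative (\<lambda>u. F (x, t) (u, 0) + K *v u)) (at x)"
proof -
  have "((\<lambda>z. f (z, t)) has_derivative (\<lambda>u. F (x, t) (u, 0))) (at x)"
    by (rule has_derivative_f) (auto intro!: derivative_eq_intros assms)
  then show ?thesis
    by (auto intro!: derivative_eq_intros linear_imp_has_derivative)
qed

lemma Dx_perturbed:
  assumes "(x, t) \<in> S"
  shows "Dx (\<lambda>(x, t). f (x, t) + y + K *v x) x t = matrix (\<lambda>u. F (x, t) (u, 0) + K *v u)"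
  by (simp add: Dx_def jacobian_def frechet_derivative_at[OF has_derivative_perturbed[OF assms], symmetric])

lemma Dx_perturbed_mult:
  assumes "(x, t) \<in> S"
  shows "Dx (\<lambda>(x, t). f (x, t) + y + K *v x) x t *v u = F (x, t) (u, 0) + K *v u"
  using has_derivative_linear[OF has_derivative_perturbed[OF assms]]
  by (simp add: Dx_perturbed[OF assms] matrix_works linear_matrix_vector_mul_eq)

lemma Dt_perturbed:
  assumes "(x, t) \<in> S"
  shows "Dt (\<lambda>(x, t). f (x, t) + y + K *v x) x t = F (x, t) (0, 1)"
proof -
  have "((\<lambda>s. f (x, s)) has_derivative (\<lambda>s. F (x, t) (0, s))) (at t)"
    by (rule has_derivative_f) (auto intro!: derivative_eq_intros assms)
  then have "((\<lambda>s. f (x, s) + y + K *v x) has_derivative (\<lambda>s. F (x, t) (0, s))) (at t)"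
    by (auto intro!: derivative_eq_intros)
  also have "(\<lambda>s. F (x, t) (0, s)) = (\<lambda>s. s *\<^sub>R F (x, t) (0, 1))"
  proof
    show "F (x, t) (0, s) = s *\<^sub>R F (x, t) (0, 1)" for s
      using linear_scale[OF linear_F[OF assms], of s "(0, 1)"] by simp
  qed
  finally show ?thesis
    unfolding Dt_def by (simp add: has_vector_derivative_def vector_derivative_at)
qed

text \<open>The arguments change places: \<open>D2x\<close> takes the direction of differentiation
  first, \<open>G\<close> takes it last.\<close>

lemma D2x_perturbed:
  assumes "(x, t) \<in> S"
  shows "D2x (\<lambda>(x, t). f (x, t) + y + K *v x) x t u v = G (x, t) (v, 0) (u, 0)"
proof -
  let ?h = "\<lambda>(x, t). f (x, t) + y + K *v x" and ?U = "{z. (z, t) \<in> S}"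
  have "continuous_on UNIV (\<lambda>z. (z, t))"
    by (intro continuous_intros)
  from open_vimage[OF open_S this] have U: "open ?U" "x \<in> ?U"
    using assms by (auto simp: vimage_def)
  have dF: "((\<lambda>z. F (z, t) \<zeta>) has_derivative (\<lambda>u. G (x, t) \<zeta> (u, 0))) (at x)" for \<zeta>
    by (rule has_derivative_compose[of "\<lambda>z. (z, t)" "\<lambda>u. (u, 0)", OF _ has_G[OF assms]])
      (auto intro!: derivative_eq_intros)
  \<comment> \<open>The matrix field is shown to be differentiable column by column, so that
    \<open>frechet_derivative\<close> in \<open>D2x\<close> is a genuine derivative. Its action on
    \<open>v\<close> is then identified by uniqueness.\<close>
  have "((\<lambda>z. \<Sum>k\<in>UNIV. column_matrix k (F (z, t) (axis k 1, 0) + K *v axis k 1)) has_derivative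
      (\<lambda>u. \<Sum>k\<in>UNIV. column_matrix k (G (x, t) (axis k 1, 0) (u, 0)))) (at x)"
    by (auto intro!: derivative_eq_intros linear_compose_has_derivative[OF linear_column_matrix] dF)
  then have "((\<lambda>z. Dx ?h z t) has_derivative
      (\<lambda>u. \<Sum>k\<in>UNIV. column_matrix k (G (x, t) (axis k 1, 0) (u, 0)))) (at x)"
    by (rule has_derivative_transform_within_open[OF _ U])
      (simp add: Dx_perturbed matrix_eq_sum_column_matrix)
  then have D: "((\<lambda>z. Dx ?h z t) has_derivative frechet_derivative (\<lambda>z. Dx ?h z t) (at x)) (at x)"
    using differentiableI frechet_derivative_works by blast
  have D1: "((\<lambda>z. Dx ?h z t *v v) has_derivative
      (\<lambda>u. frechet_derivative (\<lambda>z. Dx ?h z t) (at x) u *v v)) (at x)"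
    using bounded_bilinear.FDERIV[OF bounded_bilinear_matrix_vector_mult D has_derivative_const[of v]]
    by simp
  have D2: "((\<lambda>z. Dx ?h z t *v v) has_derivative (\<lambda>u. G (x, t) (v, 0) (u, 0))) (at x)"
  proof (rule has_derivative_transform_within_open[OF _ U])
    show "((\<lambda>z. F (z, t) (v, 0) + K *v v) has_derivative (\<lambda>u. G (x, t) (v, 0) (u, 0))) (at x)"
      using has_derivative_add[OF dF has_derivative_const] by simp
  qed (simp add: Dx_perturbed_mult)
  show ?thesis
    unfolding D2x_def by (rule fun_cong[OF has_derivative_unique[OF D1 D2]])
qed

text \<open>The parametrization reaches every \<open>(y, K)\<close> with a singular point whose
  kernel vector is normalized by \<open>v $ j = 1\<close>: \<open>z\<close> packs \<open>t\<close>
  into the \<open>j\<close>-th entry and \<open>x\<close> into the \<open>j\<close>-th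
  column.\<close>

lemma parameters_of_singular_point:
  assumes eq: "f (x, t) + y + K *v x = 0" and v: "v $ j = 1" "F (x, t) (v, 0) + K *v v = 0"
  defines "z \<equiv> (\<chi> k. if k = j then t else v $ k, zero_column j K + column_matrix j x)"
  shows "base_point j z = (x, t)" "kernel_vector j (fst z) = v" "annihilating_matrix j z = K"
    and "singular_parameters j z = (y, K)"
proof -
  show bp: "base_point j z = (x, t)"
    by (auto simp: z_def base_point_def column_def zero_column_def column_matrix_def vec_eq_iff)
  show kv: "kernel_vector j (fst z) = v"
    using v(1) by (auto simp: z_def kernel_vector_def zero_entry_def axis_def vec_eq_iff)
  have zc: "zero_column j (snd z) = zero_column j K"
    by (auto simp: z_def zero_column_def column_matrix_def vec_eq_iff)
  have split: "K = zero_column j K + column_matrix j (column j K)"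
    by (auto simp: zero_column_def column_matrix_def column_def vec_eq_iff)
  have "K *v v = zero_column j K *v v + column j K"
    using v(1) by (subst split) (simp add: algebra_simps column_matrix_mult)
  then have "annihilating_column j z = column j K"
    using v(2) by (simp add: annihilating_column_def bp kv zc algebra_simps neg_eq_iff_add_eq_0)
  then show nm: "annihilating_matrix j z = K"
    by (simp add: annihilating_matrix_def zc split[symmetric])
  show "singular_parameters j z = (y, K)"
  proof -
    have "y + (f (x, t) + K *v x) = 0"
      using eq by (simp add: algebra_simps)
    then have "- f (x, t) - K *v x = y"
      by (simp add: eq_neg_iff_add_eq_0[symmetric])
    then show ?thesis
      by (simp add: singular_parameters_def bp nm)
  qed
qed

text \<open>By contradiction: a singular point violating one of the conditions gives a nonzero
  solution of the linearized system, which makes \<open>(y, K)\<close> a critical value for some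
  index \<open>j\<close>.\<close>

lemma transversality_if_not_degenerate:
  assumes S: "S = X \<times> {0<..<T}" and yK: "\<And>j. (y, K) \<notin> singular_parameters j ` degenerate j"
  shows "transversality_conditions X T (\<lambda>(x, t). f (x, t) + y + K *v x)"
proof -
  let ?h = "\<lambda>(x, t). f (x, t) + y + K *v x"
  have "T1 ?h x t \<and> T2 ?h x t \<and> T3 ?h x t" if sing: "(x, t) \<in> singular_set X T ?h" for x t
  proof (rule ccontr)
    assume bad: "\<not> (T1 ?h x t \<and> T2 ?h x t \<and> T3 ?h x t)"
    have xt: "(x, t) \<in> S" and eq: "f (x, t) + y + K *v x = 0"
      and ninv: "\<not> invertible (Dx ?h x t)"
      using sing by (auto simp: singular_set_def S)
    define A where "A = Dx ?h x t"
    have A: "A *v u = F (x, t) (u, 0) + K *v u" for u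
      unfolding A_def by (rule Dx_perturbed_mult[OF xt])
    obtain v0 where v0: "A *v v0 = 0" "v0 \<noteq> 0"
      using ninv unfolding A_def[symmetric] invertible_left_inverse matrix_left_invertible_ker by blast
    then obtain j where j: "v0 $ j \<noteq> 0"
      by (auto simp: vec_eq_iff)
    \<comment> \<open>The index \<open>j\<close> depends on the kernel vector, which is why all
      charts \<open>j\<close> have to be avoided.\<close>
    define v where "v = (1 / v0 $ j) *\<^sub>R v0"
    have v: "A *v v = 0" "v $ j = 1"
      using v0 j by (auto simp: v_def matrix_vector_mult_scaleR)
    have H: "linear (G (x, t) (v, 0))"
      by (rule linear_G[OF xt])
    have deg: "dim (null_space A) \<noteq> 1 \<or> (\<exists>w. w \<noteq> 0 \<and> w \<in> null_space (transpose A) \<and>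
        (Dt ?h x t \<bullet> w = 0 \<or> G (x, t) (v, 0) (v, 0) \<bullet> w = 0))"
    proof (cases "dim (null_space A) = 1")
      case dim: True
      show ?thesis
      proof (cases "T2 ?h x t")
        case False
        then show ?thesis by (auto simp: T2_def A_def)
      next
        case True
        then have "\<not> T3 ?h x t"
          using bad dim by (simp add: T1_def A_def)
        then obtain v' w where v': "v' \<noteq> 0" "v' \<in> null_space A" and w: "w \<noteq> 0" "w \<in> null_space (transpose A)"
          and 0: "D2x ?h x t v' v' \<bullet> w = 0"
          by (auto simp: T3_def A_def)
        have "v \<in> null_space A" "v \<noteq> 0"
          using v by (auto simp: null_space_def)
        \<comment> \<open>(T3) may fail at a kernel vector \<open>v'\<close> other than
          \<open>v\<close>. The kernel is a line, so the quadratic form at \<open>v\<close> is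
          \<open>c^2\<close> times that at \<open>v'\<close> and is still orthogonal to
          \<open>w\<close>.\<close>
        obtain c where c: "v = c *\<^sub>R v'"
          using parallel_null_vectors[OF dim v' \<open>v \<in> null_space A\<close>] by blast
        have "D2x ?h x t v v = c *\<^sub>R D2x ?h x t v v'"
          by (simp add: D2x_def c matrix_vector_mult_scaleR)
        also have "D2x ?h x t v v' = c *\<^sub>R D2x ?h x t v' v'"
          using linear_scale[OF linear_G[OF xt], of "(v', 0)" c "(v', 0)"]
          by (simp add: D2x_perturbed[OF xt] c)
        finally have "G (x, t) (v, 0) (v, 0) \<bullet> w = 0"
          using 0 by (simp add: D2x_perturbed[OF xt])
        then show ?thesis using w by blast
      qed
    qed simp
    obtain x' t' u where ne: "(x', t', u) \<noteq> 0" and u: "u $ j = 0"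
      and eq1: "A *v x' + t' *\<^sub>R Dt ?h x t = 0" and eq2: "G (x, t) (v, 0) (x', t') + A *v u = 0"
      by (rule singular_linearization_if_degenerate[OF v H deg])
    define z where "z = (\<chi> k. if k = j then t else v $ k, zero_column j K + column_matrix j x)"
    have z: "base_point j z = (x, t)" "kernel_vector j (fst z) = v" "annihilating_matrix j z = K"
      "singular_parameters j z = (y, K)"
      using parameters_of_singular_point[OF eq v(2)] v(1) by (auto simp: z_def A)
    have F: "F (x, t) (x', t') = F (x, t) (x', 0) + t' *\<^sub>R F (x, t) (0, 1)"
      using linear_add[OF linear_F[OF xt], of "(x', 0)" "t' *\<^sub>R (0, 1)"]
        linear_scale[OF linear_F[OF xt], of t' "(0, 1)"] by simp
    have 0: "linearization j z (x', t', u) = 0"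
      using eq1[unfolded Dt_perturbed[OF xt]] eq2 u
      by (simp add: linearization_def z A F zero_prod_def algebra_simps)
    have lin: "linear (linearization j z)"
      by (rule linear_linearization) (simp add: z xt)
    let ?\<xi> = "(1 / norm (x', t', u)) *\<^sub>R (x', t', u)"
    have "linearization j z ?\<xi> = 0"
      unfolding linear_scale[OF lin] 0 by simp
    moreover have "?\<xi> \<in> sphere 0 1"
      using ne by (simp del: scaleR_Pair)
    moreover have "base_point j z \<in> S"
      using xt z(1) by simp
    ultimately have "z \<in> degenerate j"
      unfolding degenerate_def by blast
    then show False
      using yK[of j] z(4) by force
  qed
  then show ?thesis
    by (auto simp: transversality_conditions_def)
qed

end

theorem theorem1p3:
  fixes f :: "(real^'n) \<times> real \<Rightarrow> real^'n"
    and X :: "(real^'n) set"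
    and T :: real
  assumes "T > 0"
    and "open X"
    and "Ck_on 3 f (X \<times> {0<..<T})"
  shows "(\<exists>N :: ((real^'n) \<times> (real^'n^'n)) set. meagre N \<and>
            (\<forall>y K. (y, K) \<notin> N \<longrightarrow>
               transversality_conditions X T (\<lambda>(x, t). f (x, t) + y + K *v x)))
       \<and> (\<exists>N :: ((real^'n) \<times> (real^'n^'n)) set. N \<in> null_sets lebesgue \<and>
            (\<forall>y K. (y, K) \<notin> N \<longrightarrow>
               transversality_conditions X T (\<lambda>(x, t). f (x, t) + y + K *v x)))"
proof -
  let ?S = "X \<times> {0<..<T}" and ?F = "\<lambda>p. frechet_derivative f (at p)"
  let ?G = "\<lambda>p \<zeta>. frechet_derivative (\<lambda>q. ?F q \<zeta>) (at p)"
  have C3: "Ck_on (Suc (Suc (Suc 0))) f ?S"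
    using assms(3) by (simp add: numeral_3_eq_3)
  have C2: "Ck_on (Suc (Suc 0)) (\<lambda>q. ?F q \<zeta>) ?S" for \<zeta>
    using C3 by (simp only: Ck_on.simps(2)[of "Suc (Suc 0)"])
  have C1: "Ck_on (Suc 0) (\<lambda>p. ?G p \<zeta> \<eta>) ?S" for \<zeta> \<eta>
    using C2[of \<zeta>] by (simp only: Ck_on.simps(2)[of "Suc 0"])
  interpret C2_map f ?S ?F ?G
  proof
    show "open ?S"
      by (intro open_Times assms open_greaterThanLessThan)
    show "(f has_derivative ?F p) (at p)" if "p \<in> ?S" for p
      using C3 that by (rule Ck_on_frechet_derivative)
    show "((\<lambda>q. ?F q \<zeta>) has_derivative ?G p \<zeta>) (at p)" if "p \<in> ?S" for p \<zeta>
      using C2 that by (rule Ck_on_frechet_derivative)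
    show "continuous_on ?S (\<lambda>p. ?G p \<zeta> \<eta>)" for \<zeta> \<eta>
      \<comment> \<open>The second derivatives are continuous because they are
        differentiable.\<close>
      using Ck_on_frechet_derivative[OF C1]
      by (intro continuous_at_imp_continuous_on) (blast intro: has_derivative_continuous)
  qed
  \<comment> \<open>The same exceptional set serves both claims: a finite union, over the possible
    normalizing indices, of sets that are meagre as well as negligible.\<close>
  let ?N = "\<Union>j. singular_parameters j ` degenerate j"
  have "transversality_conditions X T (\<lambda>(x, t). f (x, t) + y + K *v x)" if "(y, K) \<notin> ?N" for y K
    by (rule transversality_if_not_degenerate) (use that in auto)
  moreover have "meagre ?N"
    by (intro meagre_UN meagre_degenerate) auto
  moreover have "?N \<in> null_sets lebesgue"
    unfolding negligible_iff_null_sets[symmetric]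
    by (intro negligible_Union) (auto intro: negligible_degenerate)
  ultimately show ?thesis by blast
qed

end
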